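(* Let $(X,\preccurlyeq)$ be a finite partially ordered set with $n$ elements, and let $M^X$ be the square matrix with rows and columns indexed by $\mathsf{Tot}_X$ and entries $(M^X)_{PQ}=a_{\varepsilon_{PQ}}$, viewed as a matrix over the polynomial ring $\mathbb{Z}[a_\varepsilon:\varepsilon\in\mathcal{E}]$. Then every eigenvalue of $M^X$ is a linear combination of the variables $a_\varepsilon$ with integer coefficients; that is, the characteristic polynomial of $M^X$ factors as $\prod_{i=1}^{|\mathsf{Tot}_X|}(\lambda-\ell_i)$ where each $\ell_i=\sum_{\varepsilon\in\mathcal{E}} m_{i,\varepsilon}\,a_\varepsilon$ with $m_{i,\varepsilon}\in\mathbb{Z}$.
   Context: A linear extension of the partial order $\preccurlyeq$ on $X$ is a bijection $P:X\to\{1,\dots,n\}$ such that $\alpha\preccurlyeq\beta$ implies $P(\alpha)\le P(\beta)$; $\mathsf{Tot}_X$ denotes the set of all linear extensions. For $P,Q\in\mathsf{Tot}_X$ and $2\le k\le n$, the node $Q^{-1}(k)$ is called a $(P,Q)$-disagreement node if $P(Q^{-1}(k-1))>P(Q^{-1}(k))$; the node $Q^{-1}(1)$ is never a disagreement node. Define $\varepsilon_{PQ}:\{1,\dots,n-1\}\to\{0,1\}$ by $\varepsilon_{PQ}(k)=1$ if $Q^{-1}(k+1)$ is a $(P,Q)$-disagreement node and $\varepsilon_{PQ}(k)=0$ otherwise. Let $\mathcal{E}$ be the set of all $2^{n-1}$ functions $\varepsilon:\{1,\dots,n-1\}\to\{0,1\}$, and to each $\varepsilon\in\mathcal{E}$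 associate an independent formal variable $a_\varepsilon$. *)

theory Defs
  imports
    "Jordan_Normal_Form.Char_Poly"
    "HOL-Library.Poly_Mapping"
    "HOL-Library.FuncSet"
begin

definition linear_extensions :: "'a set \<Rightarrow> ('a \<times> 'a) set \<Rightarrow> ('a \<Rightarrow> nat) set" where
  "linear_extensions X r =
     {P \<in> X \<rightarrow>\<^sub>E {1..card X}. bij_betw P X {1..card X} \<and>
        (\<forall>\<alpha>\<in>X. \<forall>\<beta>\<in>X. (\<alpha>, \<beta>) \<in> r \<longrightarrow> P \<alpha> \<le> P \<beta>)}"

definition disagreement_node :: "'a set \<Rightarrow> ('a \<Rightarrow> nat) \<Rightarrow> ('a \<Rightarrow> nat) \<Rightarrow> 'a \<Rightarrow> bool" where
  "disagreement_node X P Q v \<longleftrightarrow>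
     (\<exists>k\<in>{2..card X}. v = inv_into X Q k \<and> P (inv_into X Q (k - 1)) > P (inv_into X Q k))"

definition signs :: "nat \<Rightarrow> (nat \<Rightarrow> nat) set" where
  "signs n = {1..n - 1} \<rightarrow>\<^sub>E {0, 1}"

definition disagreement_sign :: "'a set \<Rightarrow> ('a \<Rightarrow> nat) \<Rightarrow> ('a \<Rightarrow> nat) \<Rightarrow> nat \<Rightarrow> nat" where
  "disagreement_sign X P Q =
     (\<lambda>k\<in>{1..card X - 1}. if disagreement_node X P Q (inv_into X Q (k + 1)) then 1 else 0)"

text \<open>
  Integer polynomials are finitely supported maps from monomials to coefficients, monomials being
  finitely supported maps from variables to exponents. Since the number of variables depends on
  the size of the poset, the variables are named by arbitrary functions on the naturals; only
  those in \<^term>\<open>signs (card X)\<close> occur in the matrix below.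
\<close>

type_synonym sign_poly = "((nat \<Rightarrow> nat) \<Rightarrow>\<^sub>0 nat) \<Rightarrow>\<^sub>0 int"

definition sign_var :: "(nat \<Rightarrow> nat) \<Rightarrow> sign_poly" where
  "sign_var \<epsilon> = Poly_Mapping.single (Poly_Mapping.single \<epsilon> 1) 1"

text \<open>
  Matrices are indexed by initial segments of the naturals, so the rows and columns are matched
  with the linear extensions through an enumeration \<open>Ps\<close> of them.
\<close>

definition extension_matrix :: "'a set \<Rightarrow> ('a \<Rightarrow> nat) list \<Rightarrow> sign_poly mat" where
  "extension_matrix X Ps =
     mat (length Ps) (length Ps) (\<lambda>(i, j). sign_var (disagreement_sign X (Ps ! i) (Ps ! j)))"

lemma finite_linear_extensions: "finite X \<Longrightarrow> finite (linear_extensions X r)"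
  unfolding linear_extensions_def by (rule finite_subset[OF _ finite_PiE[of X "\<lambda>_. {1..card X}"]]) auto

lemma disagreement_sign_in_signs: "disagreement_sign X P Q \<in> signs (card X)"
  unfolding disagreement_sign_def signs_def by auto

lemma card_signs: "card (signs n) = 2 ^ (n - 1)"
  unfolding signs_def by (simp add: card_PiE numeral_2_eq_2)

end

theory Submission imports Defs begin

text \<open>
  Total preorders on \<open>X\<close> extending the partial order (faces) form a finite monoid under lexicographic
  refinement, which acts on linear extensions. Writing \<open>a S\<close> for the variable whose sign is the
  indicator of \<open>S\<close>, and \<open>a S = (\<Sum>T \<supseteq> S. \<beta> T)\<close>, the matrix becomes
  \<open>M = (\<Sum>F. w F * \<rho> F)\<close>, where \<open>\<rho> F\<close> is the action of the face \<open>F\<close> and \<open>w F\<close> is \<open>\<beta>\<close> of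
  the set of positions at which \<open>F\<close> is cut into blocks: the faces taking \<open>P\<close> to \<open>Q\<close> correspond to the
  cut sets containing all descents of \<open>P\<close> along \<open>Q\<close>.

  Right multiplication on the monoid is triangular, since \<open>G F\<close> is either \<open>G\<close> or a proper refinement
  of \<open>G\<close>. Hence \<open>M\<close> is annihilated by a product of factors \<open>\<lambda> - (\<Sum>F \<in> A. w F)\<close> for suitable sets
  \<open>A\<close> of faces. The characteristic polynomial divides a power of this product, so over an integral
  domain it is itself a product of such factors.
\<close>

section \<open>Annihilating polynomials and characteristic polynomials\<close>

text \<open>
  The right-hand side is \<open>(\<lambda> - M) h\<close> with \<open>M = (\<Sum>F. w F * \<rho> F)\<close>. Having the annihilation in this form,
  over the polynomial ring, makes the divisibility of determinants immediate.
\<close>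
lemma left_action_annihilator:
  fixes w :: "'s \<Rightarrow> 'd::comm_ring_1" and act :: "'s \<Rightarrow> 'c \<Rightarrow> 'c" and \<mu> :: "'s \<Rightarrow> nat"
  assumes S: "finite S"
    and mul: "\<And>G F. G \<in> S \<Longrightarrow> F \<in> S \<Longrightarrow> mul G F \<in> S"
    and act: "\<And>F c. F \<in> S \<Longrightarrow> c \<in> C \<Longrightarrow> act F c \<in> C"
    and act_mul: "\<And>G F c. G \<in> S \<Longrightarrow> F \<in> S \<Longrightarrow> c \<in> C \<Longrightarrow> act (mul G F) c = act G (act F c)"
    and dec: "\<And>G F. G \<in> S \<Longrightarrow> F \<in> S \<Longrightarrow> mul G F \<noteq> G \<Longrightarrow> \<mu> (mul G F) < \<mu> G"
    and "G \<in> S"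
  shows "\<exists>As. (\<forall>A\<in>set As. A \<subseteq> S) \<and>
    (\<forall>f. \<exists>h. \<forall>c\<in>C. (\<Prod>A\<leftarrow>As. [:- sum w A, 1:]) * f (act G c) =
      [:0, 1:] * h c - (\<Sum>F\<in>S. [:w F:] * h (act F c)))"
  using \<open>G \<in> S\<close>
proof (induction "\<mu> G" arbitrary: G rule: less_induct)
  case less
  define D where "D h c = [:0, 1:] * h c - (\<Sum>F\<in>S. [:w F:] * h (act F c))" for h :: "'c \<Rightarrow> 'd poly" and c
  define x :: "'d poly" where "x = [:0, 1:]"
  define W where "W F = [:w F:]" for F
  have D: "D h c = x * h c - (\<Sum>F\<in>S. W F * h (act F c))" for h c
    by (simp add: D_def W_def x_def)
  have W_sum: "sum W A = [:sum w A:]" for A by (simp add: W_def sum_to_poly)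
  define \<pi> where "\<pi> As = (\<Prod>A\<leftarrow>As. [:- sum w A, 1:])" for As
  have "\<forall>G'\<in>S. \<mu> G' < \<mu> G \<longrightarrow> (\<exists>As. (\<forall>A\<in>set As. A \<subseteq> S) \<and>
    (\<forall>f. \<exists>h. \<forall>c\<in>C. \<pi> As * f (act G' c) = D h c))"
    using less(1) unfolding D_def \<pi>_def by blast
  then obtain L where L: "\<And>G'. G' \<in> S \<Longrightarrow> \<mu> G' < \<mu> G \<Longrightarrow> \<forall>A\<in>set (L G'). A \<subseteq> S"
    and IH: "\<And>G' f. G' \<in> S \<Longrightarrow> \<mu> G' < \<mu> G \<Longrightarrow> \<exists>h. \<forall>c\<in>C. \<pi> (L G') * f (act G' c) = D h c"
    by metis
  \<comment> \<open>The elements outside \<open>T\<close> fix \<open>G\<close> from the right, so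
    together they act on \<open>f (act G c)\<close> as the scalar \<open>sum W (S - T)\<close>.
    Those in \<open>T\<close> lower \<mu> and fall under the induction hypothesis.\<close>
  define T where "T = {F \<in> S. mul G F \<noteq> G}"
  have T: "finite T" "T \<subseteq> S" using S by (auto simp: T_def)
  obtain Fs where Fs: "set Fs = T" "distinct Fs" using finite_distinct_list[OF T(1)] by blast
  \<comment> \<open>One common multiplier that brings every term \<open>f (act (mul G F) c)\<close>
    with \<open>F\<close> in \<open>T\<close> into the range of \<open>D\<close>.\<close>
  define q where "q = (\<Prod>F\<in>T. \<pi> (L (mul G F)))"
  define As where "As = (S - T) # concat (map (\<lambda>F. L (mul G F)) Fs)"
  have "\<pi> (concat xss) = prod_list (map \<pi> xss)" for xss
    by (induction xss) (auto simp: \<pi>_def)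
  then have "\<pi> (concat (map (\<lambda>F. L (mul G F)) Fs)) = q"
    unfolding q_def using prod.distinct_set_conv_list[OF Fs(2), of "\<lambda>F. \<pi> (L (mul G F))"]
    by (simp add: Fs(1) o_def)
  then have As: "\<pi> As = (x - sum W (S - T)) * q"
    by (simp add: As_def \<pi>_def x_def W_sum)
  have "\<exists>h. \<forall>c\<in>C. \<pi> As * f (act G c) = D h c" for f :: "'c \<Rightarrow> 'd poly"
  proof -
    \<comment> \<open>The factors of \<open>q\<close> belonging to the other elements of
      \<open>T\<close> are absorbed into \<open>f\<close>, which the induction hypothesis leaves
      arbitrary.\<close>
    have "\<exists>h. \<forall>c\<in>C. q * f (act (mul G F) c) = D h c" if F: "F \<in> T" for F
    proof -
      obtain h where h: "\<forall>c\<in>C. \<pi> (L (mul G F)) *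
          ((\<Prod>F'\<in>T - {F}. \<pi> (L (mul G F'))) * f (act (mul G F) c)) = D h c"
        using IH[of "mul G F" "\<lambda>c. (\<Prod>F'\<in>T - {F}. \<pi> (L (mul G F'))) * f c"] F mul dec less.prems
        by (auto simp: T_def)
      moreover have "q = \<pi> (L (mul G F)) * (\<Prod>F'\<in>T - {F}. \<pi> (L (mul G F')))"
        unfolding q_def by (rule prod.remove[OF T(1) F])
      ultimately show ?thesis by (auto simp: mult.assoc)
    qed
    then obtain h where h: "\<And>F c. F \<in> T \<Longrightarrow> c \<in> C \<Longrightarrow> q * f (act (mul G F) c) = D (h F) c"
      by metis
    \<comment> \<open>Applying \<open>D\<close> to the first summand gives the wanted scalar
      multiple of \<open>q * f (act G c)\<close> minus the terms from \<open>T\<close>. Those terms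
      are \<open>W F * D (h F) c\<close>, so the second summand restores them.\<close>
    define h' where "h' c = q * f (act G c) + (\<Sum>F\<in>T. W F * h F c)" for c
    have "\<pi> As * f (act G c) = D h' c" if c: "c \<in> C" for c
    proof -
      have *: "W F * h' (act F c) =
          W F * (q * f (act (mul G F) c)) + (\<Sum>F'\<in>T. W F' * (W F * h F' (act F c)))"
        if "F \<in> S" for F
        using that c act act_mul less.prems
        by (simp add: h'_def distrib_left sum_distrib_left mult.left_commute)
      have "(\<Sum>F\<in>S. W F * h' (act F c)) = (\<Sum>F\<in>S. W F * (q * f (act (mul G F) c))) +
          (\<Sum>F\<in>S. \<Sum>F'\<in>T. W F' * (W F * h F' (act F c)))"
        by (simp add: * sum.distrib)
      also have "(\<Sum>F\<in>S. W F * (q * f (act (mul G F) c))) =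
          (\<Sum>F\<in>S - T. W F * (q * f (act G c))) + (\<Sum>F\<in>T. W F * (q * f (act (mul G F) c)))"
        using S T by (subst sum.subset_diff[of T]) (auto simp: T_def)
      also have "(\<Sum>F\<in>S - T. W F * (q * f (act G c))) = sum W (S - T) * (q * f (act G c))"
        by (simp add: sum_distrib_right)
      also have "(\<Sum>F\<in>S. \<Sum>F'\<in>T. W F' * (W F * h F' (act F c))) =
          (\<Sum>F'\<in>T. W F' * (\<Sum>F\<in>S. W F * h F' (act F c)))"
        by (subst sum.swap) (simp add: sum_distrib_left)
      finally have 1: "(\<Sum>F\<in>S. W F * h' (act F c)) = sum W (S - T) * (q * f (act G c)) +
          (\<Sum>F\<in>T. W F * (q * f (act (mul G F) c))) + (\<Sum>F'\<in>T. W F' * (\<Sum>F\<in>S. W F * h F' (act F c)))" .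
      have 2: "x * h' c = x * (q * f (act G c)) + (\<Sum>F\<in>T. W F * (x * h F c))"
        by (simp add: h'_def distrib_left sum_distrib_left mult.left_commute)
      have "(\<Sum>F\<in>T. W F * (q * f (act (mul G F) c))) = (\<Sum>F\<in>T. W F * D (h F) c)"
        using h c by (intro sum.cong) auto
      also have "\<dots> = (\<Sum>F\<in>T. W F * (x * h F c)) - (\<Sum>F'\<in>T. W F' * (\<Sum>F\<in>S. W F * h F' (act F c)))"
        by (simp only: D right_diff_distrib sum_subtractf)
      finally have "D h' c = x * (q * f (act G c)) - sum W (S - T) * (q * f (act G c))"
        unfolding D 1 2 by simp
      also have "\<dots> = \<pi> As * f (act G c)"
        by (simp only: As mult.assoc left_diff_distrib)
      finally show ?thesis ..
    qed
    then show ?thesis by blast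
  qed
  moreover have "A \<subseteq> S" if "F \<in> T" "A \<in> set (L (mul G F))" for F A
    using L[of "mul G F"] that dec mul less.prems by (auto simp: T_def)
  then have "\<forall>A\<in>set As. A \<subseteq> S"
    using T by (auto simp: As_def Fs)
  ultimately show ?case unfolding \<pi>_def D_def by blast
qed

section \<open>Divisors of annihilating polynomials\<close>

text \<open>The vectors \<open>h\<close> supplied for the unit vectors are the columns of a matrix
  \<open>Q\<close> with \<open>char_poly_matrix A * Q\<close> equal to \<open>p\<close> times the
  identity. Taking determinants gives the divisibility.\<close>

lemma char_poly_dvd_power:
  fixes A :: "'d::comm_ring_1 mat"
  assumes A: "A \<in> carrier_mat n n"
    and ex: "\<And>j. j < n \<Longrightarrow> \<exists>h. \<forall>i<n. (if i = j then p else 0) =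
      [:0, 1:] * h i - (\<Sum>k<n. [:A $$ (i, k):] * h k)"
  shows "char_poly A dvd p ^ n"
proof -
  define good where "good j h \<longleftrightarrow> (\<forall>i<n. (if i = j then p else 0) =
      [:0, 1:] * h i - (\<Sum>k<n. [:A $$ (i, k):] * h k))" for j h
  obtain h where good: "\<And>j. j < n \<Longrightarrow> good j (h j)"
    using ex unfolding good_def[symmetric] by metis
  have h: "(if i = j then p else 0) = [:0, 1:] * h j i - (\<Sum>k<n. [:A $$ (i, k):] * h j k)"
    if "j < n" "i < n" for i j
    using good[OF that(1)] that(2) unfolding good_def by blast
  define Q where "Q = mat n n (\<lambda>(i, j). h j i)"
  have Q: "Q \<in> carrier_mat n n" by (simp add: Q_def)
  have cA: "char_poly_matrix A \<in> carrier_mat n n" using A by simp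
  have "char_poly_matrix A * Q = p \<cdot>\<^sub>m 1\<^sub>m n"
  proof (rule eq_matI)
    fix i j assume "i < dim_row (p \<cdot>\<^sub>m 1\<^sub>m n)" "j < dim_col (p \<cdot>\<^sub>m 1\<^sub>m n)"
    then have ij: "i < n" "j < n" by auto
    have "(char_poly_matrix A * Q) $$ (i, j) =
        (\<Sum>k<n. ((if i = k then [:0, 1:] else 0) - [:A $$ (i, k):]) * h j k)"
      using ij A cA Q by (auto simp: scalar_prod_def char_poly_matrix_def Q_def atLeast0LessThan intro!: sum.cong)
    also have "\<dots> = (\<Sum>k<n. if i = k then [:0, 1:] * h j k else 0) - (\<Sum>k<n. [:A $$ (i, k):] * h j k)"
      unfolding sum_subtractf[symmetric] by (rule sum.cong) (auto simp: left_diff_distrib)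
    also have "\<dots> = [:0, 1:] * h j i - (\<Sum>k<n. [:A $$ (i, k):] * h j k)"
      using ij by (subst sum.delta') auto
    also have "\<dots> = (p \<cdot>\<^sub>m 1\<^sub>m n) $$ (i, j)"
      unfolding h[OF ij(2,1), symmetric] using ij by auto
    finally show "(char_poly_matrix A * Q) $$ (i, j) = (p \<cdot>\<^sub>m 1\<^sub>m n) $$ (i, j)" .
  qed (use cA Q in auto)
  then have "det (char_poly_matrix A) * det Q = p ^ n"
    using det_mult[OF cA Q] by simp
  then show ?thesis unfolding char_poly_def by (metis dvd_triv_left)
qed

text \<open>At a root \<open>a\<close> of the product either \<open>q\<close> or its cofactor
  vanishes, because the values lie in a domain. The factor \<open>[:- a, 1:]\<close> is split off
  from that one and cancelled. Monicity survives and forces \<open>q = 1\<close> at the end.\<close>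

lemma monic_dvd_prod_linear:
  fixes q :: "'d::idom poly"
  assumes "q dvd (\<Prod>a\<leftarrow>as. [:- a, 1:])" and "lead_coeff q = 1"
  shows "\<exists>bs. set bs \<subseteq> set as \<and> q = (\<Prod>b\<leftarrow>bs. [:- b, 1:])"
  using assms
proof (induction as arbitrary: q)
  case Nil
  then have "degree q = 0" by (metis degree_1 dvd_imp_degree_le list.simps(8) prod_list.Nil le_zero_eq zero_neq_one)
  then have "q = 1" using Nil.prems(2) by (metis degree_eq_zeroE lead_coeff_pCons(2) one_pCons)
  then show ?case by (intro exI[of _ "[]"]) simp
next
  case (Cons a as)
  obtain d where d: "[:- a, 1:] * (\<Prod>a\<leftarrow>as. [:- a, 1:]) = q * d" using Cons.prems(1) unfolding list.map prod_list.Cons by (elim dvdE)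
  then have "poly (q * d) a = 0" by (metis mult_eq_0_iff poly_eq_0_iff_dvd dvd_triv_left)
  then consider "poly q a = 0" | "poly d a = 0" by auto
  then show ?case
  proof cases
    case 1
    then obtain q' where q': "q = [:- a, 1:] * q'" unfolding poly_eq_0_iff_dvd by (elim dvdE)
    have "[:- a, 1:] * (\<Prod>a\<leftarrow>as. [:- a, 1:]) = [:- a, 1:] * (q' * d)" using d q' by (simp only: mult.assoc)
    then have "(\<Prod>a\<leftarrow>as. [:- a, 1:]) = q' * d" by (subst (asm) mult_cancel_left) simp
    moreover have "lead_coeff q' = 1" using Cons.prems(2) unfolding q' lead_coeff_mult by simp
    ultimately obtain bs where "set bs \<subseteq> set as" "q' = (\<Prod>b\<leftarrow>bs. [:- b, 1:])"
      using Cons.IH[of q'] by auto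
    then show ?thesis by (intro exI[of _ "a # bs"]) (auto simp: q')
  next
    case 2
    then obtain d' where d': "d = [:- a, 1:] * d'" unfolding poly_eq_0_iff_dvd by (elim dvdE)
    have "[:- a, 1:] * (\<Prod>a\<leftarrow>as. [:- a, 1:]) = [:- a, 1:] * (q * d')" using d d' by (simp only: mult.left_commute)
    then have "(\<Prod>a\<leftarrow>as. [:- a, 1:]) = q * d'" by (subst (asm) mult_cancel_left) simp
    then obtain bs where "set bs \<subseteq> set as" "q = (\<Prod>b\<leftarrow>bs. [:- b, 1:])"
      using Cons.IH[of q] Cons.prems(2) by auto
    then show ?thesis by auto
  qed
qed

section \<open>Faces acting on linear extensions\<close>

definition order_of :: "'a set \<Rightarrow> ('a \<Rightarrow> nat) \<Rightarrow> ('a \<times> 'a) set" where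
  "order_of X P = {(a, b) \<in> X \<times> X. P a \<le> P b}"

definition faces :: "'a set \<Rightarrow> ('a \<times> 'a) set \<Rightarrow> ('a \<times> 'a) set set" where
  "faces X r = {F. F \<subseteq> X \<times> X \<and> (\<forall>a\<in>X. \<forall>b\<in>X. (a, b) \<in> F \<or> (b, a) \<in> F) \<and> trans F \<and> r \<inter> X \<times> X \<subseteq> F}"

text \<open>This is the face product of the braid arrangement: \<open>F\<close> decides first, and
  \<open>G\<close> breaks the ties of \<open>F\<close>.\<close>

definition face_mult :: "('a \<times> 'a) set \<Rightarrow> ('a \<times> 'a) set \<Rightarrow> ('a \<times> 'a) set" where
  "face_mult F G = {(a, b) \<in> F. (b, a) \<in> F \<longrightarrow> (a, b) \<in> G}"

text \<open>On a total order this recovers the position function; on a preorder it is constant on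
  blocks. The restriction to \<open>X\<close> yields the extensional functions that
  \<open>linear_extensions\<close> consists of.\<close>

definition rank_of :: "'a set \<Rightarrow> ('a \<times> 'a) set \<Rightarrow> 'a \<Rightarrow> nat" where
  "rank_of X F = (\<lambda>a\<in>X. card {b \<in> X. (b, a) \<in> F})"

definition face_act :: "'a set \<Rightarrow> ('a \<times> 'a) set \<Rightarrow> ('a \<Rightarrow> nat) \<Rightarrow> 'a \<Rightarrow> nat" where
  "face_act X F P = rank_of X (face_mult F (order_of X P))"

lemma finite_faces: "finite X \<Longrightarrow> finite (faces X r)"
  by (rule finite_subset[of _ "Pow (X \<times> X)"]) (auto simp: faces_def)

lemma linear_extensionsD:
  assumes "P \<in> linear_extensions X r"
  shows "P \<in> X \<rightarrow>\<^sub>E {1..card X}" "inj_on P X" "P ` X = {1..card X}"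
    "\<And>a b. (a, b) \<in> r \<Longrightarrow> a \<in> X \<Longrightarrow> b \<in> X \<Longrightarrow> P a \<le> P b"
  using assms by (auto simp: linear_extensions_def bij_betw_def)

lemma order_of_faces:
  assumes "P \<in> linear_extensions X r"
  shows "order_of X P \<in> faces X r" "antisym (order_of X P)"
  using linear_extensionsD[OF assms]
  by (auto simp: faces_def order_of_def trans_def antisym_def inj_on_def)

lemma face_mult_faces:
  assumes "F \<in> faces X r" "G \<in> faces X r"
  shows "face_mult F G \<in> faces X r"
proof -
  have "trans F" "trans G" using assms by (auto simp: faces_def)
  then have "trans (face_mult F G)"
    unfolding trans_def face_mult_def by (auto; blast)
  then show ?thesis using assms by (auto simp: faces_def face_mult_def)
qed

lemma face_mult_antisym: "antisym G \<Longrightarrow> antisym (face_mult F G)"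
  by (auto simp: face_mult_def antisym_def)

lemma face_mult_assoc: "face_mult (face_mult F G) H = face_mult F (face_mult G H)"
  by (auto simp: face_mult_def)

text \<open>As a set of pairs, \<open>face_mult G F\<close> is contained in \<open>G\<close>. Hence
  \<open>card\<close> can serve as the measure in \<open>left_action_annihilator\<close>.\<close>

lemma card_face_mult_less:
  assumes "finite X" "G \<in> faces X r" "face_mult G F \<noteq> G"
  shows "card (face_mult G F) < card G"
proof (rule psubset_card_mono)
  show "finite G" using assms by (auto simp: faces_def intro: finite_subset)
  show "face_mult G F \<subset> G" using assms(3) by (auto simp: face_mult_def)
qed

lemma card_initial_segment:
  assumes "Q \<in> linear_extensions X r" "k \<le> card X"
  shows "card {b \<in> X. Q b \<le> k} = k"
proof -
  note Q = linear_extensionsD[OF assms(1)]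
  have "Q ` {b \<in> X. Q b \<le> k} = {1..k}"
    using Q(3) assms(2) by (auto simp: set_eq_iff image_iff) (metis atLeastAtMost_iff le_trans)+
  then show ?thesis
    using card_image[OF inj_on_subset[OF Q(2)], of "{b \<in> X. Q b \<le> k}"] by auto
qed

lemma rank_of_order_of:
  assumes "P \<in> linear_extensions X r"
  shows "rank_of X (order_of X P) = P"
proof
  fix a
  note P = linear_extensionsD[OF assms]
  show "rank_of X (order_of X P) a = P a"
  proof (cases "a \<in> X")
    case True
    then have "card {b \<in> X. P b \<le> P a} = P a"
      using P(3) by (intro card_initial_segment[OF assms]) auto
    moreover have "{b \<in> X. (b, a) \<in> order_of X P} = {b \<in> X. P b \<le> P a}"
      using True by (auto simp: order_of_def)
    ultimately show ?thesis using True by (simp add: rank_of_def)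
  next
    case False
    then show ?thesis using P(1) by (auto simp: rank_of_def)
  qed
qed

text \<open>Lower sets of a total preorder are nested, so comparing their sizes amounts to comparing
  them by inclusion.\<close>

lemma face_rank_le_iff:
  assumes "finite X" "F \<in> faces X r" "a \<in> X" "b \<in> X"
  shows "card {c \<in> X. (c, a) \<in> F} \<le> card {c \<in> X. (c, b) \<in> F} \<longleftrightarrow> (a, b) \<in> F"
proof
  assume "(a, b) \<in> F"
  then have "{c \<in> X. (c, a) \<in> F} \<subseteq> {c \<in> X. (c, b) \<in> F}"
    using assms(2) by (auto simp: faces_def trans_def)
  then show "card {c \<in> X. (c, a) \<in> F} \<le> card {c \<in> X. (c, b) \<in> F}"
    using assms(1) by (auto intro: card_mono)
next
  assume *: "card {c \<in> X. (c, a) \<in> F} \<le> card {c \<in> X. (c, b) \<in> F}"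
  show "(a, b) \<in> F"
  proof (rule ccontr)
    assume "(a, b) \<notin> F"
    then have "(a, a) \<in> F" "(b, a) \<in> F" using assms(2-4) by (auto simp: faces_def)
    moreover have "(c, a) \<in> F" if "(c, b) \<in> F" for c
      using assms(2) that \<open>(b, a) \<in> F\<close> unfolding faces_def by (blast dest: transD)
    ultimately have "{c \<in> X. (c, b) \<in> F} \<subset> {c \<in> X. (c, a) \<in> F}"
      using \<open>(a, b) \<notin> F\<close> assms(3) by blast
    then have "card {c \<in> X. (c, b) \<in> F} < card {c \<in> X. (c, a) \<in> F}"
      using assms(1) by (intro psubset_card_mono) auto
    then show False using * by simp
  qed
qed

text \<open>Antisymmetry makes the rank injective, and an injection from \<open>X\<close> into
  \<open>{1..card X}\<close> is onto. With \<open>rank_of_order_of\<close> this identifies linear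
  extensions with antisymmetric faces.\<close>

lemma rank_linear_extension:
  assumes "finite X" "F \<in> faces X r" "antisym F"
  shows "rank_of X F \<in> linear_extensions X r" "order_of X (rank_of X F) = F"
proof -
  have le: "rank_of X F a \<le> rank_of X F b \<longleftrightarrow> (a, b) \<in> F" if "a \<in> X" "b \<in> X" for a b
    using face_rank_le_iff[OF assms(1,2) that] that by (simp add: rank_of_def)
  have "rank_of X F a \<in> {1..card X}" if "a \<in> X" for a
  proof -
    have "a \<in> {b \<in> X. (b, a) \<in> F}" using assms(2) that by (auto simp: faces_def)
    then have "card {b \<in> X. (b, a) \<in> F} > 0" using assms(1) by (auto simp: card_gt_0_iff)
    moreover have "card {b \<in> X. (b, a) \<in> F} \<le> card X" using assms(1) by (auto intro: card_mono)
    ultimately show ?thesis using that by (auto simp: rank_of_def)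
  qed
  then have PiE: "rank_of X F \<in> X \<rightarrow>\<^sub>E {1..card X}" by (auto simp: rank_of_def)
  have inj: "inj_on (rank_of X F) X"
    using le assms(3) by (auto simp: inj_on_def antisym_def) (metis order_refl)
  have "rank_of X F ` X = {1..card X}"
    using PiE inj by (intro card_subset_eq) (auto simp: card_image)
  then show "rank_of X F \<in> linear_extensions X r"
    using PiE inj le assms(2) by (auto simp: linear_extensions_def bij_betw_def faces_def)
  show "order_of X (rank_of X F) = F"
    using le assms(2) by (auto simp: order_of_def faces_def)
qed

lemma face_act:
  assumes "finite X" "F \<in> faces X r" "P \<in> linear_extensions X r"
  shows "face_act X F P \<in> linear_extensions X r"
    "order_of X (face_act X F P) = face_mult F (order_of X P)"
proof -
  note order_of_faces[OF assms(3)]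
  then have "face_mult F (order_of X P) \<in> faces X r" "antisym (face_mult F (order_of X P))"
    using face_mult_faces[OF assms(2)] face_mult_antisym by blast+
  then show "face_act X F P \<in> linear_extensions X r"
    "order_of X (face_act X F P) = face_mult F (order_of X P)"
    unfolding face_act_def by (rule rank_linear_extension[OF assms(1)])+
qed

lemma face_act_mult:
  assumes "finite X" "F \<in> faces X r" "P \<in> linear_extensions X r"
  shows "face_act X (face_mult G F) P = face_act X G (face_act X F P)"
  using face_act(2)[OF assms] by (simp add: face_act_def face_mult_assoc)

lemma top_face: "X \<times> X \<in> faces X r"
  by (auto simp: faces_def trans_def)

lemma face_act_top:
  assumes "P \<in> linear_extensions X r"
  shows "face_act X (X \<times> X) P = P"
proof -
  have "face_mult (X \<times> X) (order_of X P) = order_of X P"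
    by (auto simp: face_mult_def order_of_def)
  then show ?thesis using rank_of_order_of[OF assms] by (simp add: face_act_def)
qed

lemma face_act_eq_iff:
  assumes "finite X" "F \<in> faces X r" "P \<in> linear_extensions X r" "Q \<in> linear_extensions X r"
  shows "face_act X F P = Q \<longleftrightarrow> face_mult F (order_of X P) = order_of X Q"
  using face_act(2)[OF assms(1-3)] rank_of_order_of[OF assms(4)] by (auto simp: face_act_def)

section \<open>Faces containing a linear order and their cut positions\<close>

text \<open>With the blocks of a face listed in increasing order, these are the partial sums of the
  block sizes. The last sum, \<open>card X\<close>, separates nothing and is removed.\<close>

definition cuts :: "'a set \<Rightarrow> ('a \<times> 'a) set \<Rightarrow> nat set" where
  "cuts X F = (\<lambda>a. card {b \<in> X. (b, a) \<in> F}) ` X - {card X}"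

text \<open>The list of \<open>X\<close> in the order of \<open>Q\<close> is cut after each position
  in \<open>S\<close>. A pair \<open>(b, a)\<close> of \<open>X\<close> is left out exactly when
  some cut \<open>s\<close> satisfies \<open>Q a \<le> s\<close> and \<open>s < Q b\<close>.\<close>

definition cut_face :: "'a set \<Rightarrow> ('a \<Rightarrow> nat) \<Rightarrow> nat set \<Rightarrow> ('a \<times> 'a) set" where
  "cut_face X Q S = {(b, a) \<in> X \<times> X. \<forall>s\<in>S. Q a \<le> s \<longrightarrow> Q b \<le> s}"

text \<open>The descent set of the word of \<open>P\<close>-values read along \<open>Q\<close>. A
  descent is named by the earlier of its two positions, so that it is a possible cut.\<close>

definition descents :: "'a set \<Rightarrow> ('a \<Rightarrow> nat) \<Rightarrow> ('a \<Rightarrow> nat) \<Rightarrow> nat set" where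
  "descents X P Q = {k \<in> {1..card X - 1}. P (inv_into X Q (k + 1)) < P (inv_into X Q k)}"

lemma disagreement_sign_descents:
  assumes "Q \<in> linear_extensions X r"
  shows "disagreement_sign X P Q = (\<lambda>k\<in>{1..card X - 1}. if k \<in> descents X P Q then 1 else 0)"
proof -
  note Q = linear_extensionsD[OF assms]
  have "disagreement_node X P Q (inv_into X Q (k + 1)) \<longleftrightarrow> k \<in> descents X P Q"
    if k: "k \<in> {1..card X - 1}" for k
  proof -
    \<comment> \<open>Injectivity of the inverse of \<open>Q\<close> on positions removes the
      existential quantifier in \<open>disagreement_node\<close>.\<close>
    have "k' = k + 1" if "k' \<in> {2..card X}" "inv_into X Q (k + 1) = inv_into X Q k'" for k'
      using inv_into_injective[OF that(2)] that(1) k Q(3) by auto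
    then have "disagreement_node X P Q (inv_into X Q (k + 1)) \<longleftrightarrow>
        k + 1 \<in> {2..card X} \<and> P (inv_into X Q (k + 1)) < P (inv_into X Q (k + 1 - 1))"
      unfolding disagreement_node_def by blast
    then show ?thesis using k by (auto simp: descents_def)
  qed
  then show ?thesis unfolding disagreement_sign_def by (intro restrict_ext) auto
qed

lemma cut_face_faces:
  assumes "Q \<in> linear_extensions X r"
  shows "cut_face X Q S \<in> faces X r"
proof -
  have "(a, b) \<in> cut_face X Q S" if "a \<in> X" "b \<in> X" "Q a \<le> Q b" for a b
    using that by (auto simp: cut_face_def)
  moreover have "trans (cut_face X Q S)" by (auto simp: trans_def cut_face_def)
  moreover have "cut_face X Q S \<subseteq> X \<times> X" by (auto simp: cut_face_def)
  ultimately show ?thesis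
    using linear_extensionsD(4)[OF assms] nat_le_linear unfolding faces_def by blast
qed

text \<open>The lower set of \<open>a\<close> ends at the first cut \<open>s\<close> with
  \<open>Q a \<le> s\<close>, hence has size \<open>s\<close>; without such a cut it is all of
  \<open>X\<close>, whose size is excluded. Conversely, a cut \<open>s\<close> is attained at the
  element in position \<open>s\<close>.\<close>

lemma cuts_cut_face:
  assumes "finite X" "Q \<in> linear_extensions X r" "S \<subseteq> {1..card X - 1}"
  shows "cuts X (cut_face X Q S) = S"
proof -
  note Q = linear_extensionsD[OF assms(2)]
  have down: "{b \<in> X. (b, a) \<in> cut_face X Q S} = {b \<in> X. \<forall>s\<in>S. Q a \<le> s \<longrightarrow> Q b \<le> s}"
    if "a \<in> X" for a using that by (auto simp: cut_face_def)
  have least: "card {b \<in> X. (b, a) \<in> cut_face X Q S} = s"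
    if "a \<in> X" "s \<in> S" "Q a \<le> s" "\<And>t. t \<in> S \<Longrightarrow> Q a \<le> t \<Longrightarrow> s \<le> t" for a s
  proof -
    have "{b \<in> X. (b, a) \<in> cut_face X Q S} = {b \<in> X. Q b \<le> s}"
      unfolding down[OF that(1)] using that by (auto intro: order_trans)
    then show ?thesis using card_initial_segment[OF assms(2), of s] that(2) assms(3) by force
  qed
  show ?thesis
  proof (intro equalityI subsetI)
    fix s assume "s \<in> cuts X (cut_face X Q S)"
    then obtain a where a: "a \<in> X" "s = card {b \<in> X. (b, a) \<in> cut_face X Q S}" "s \<noteq> card X"
      by (auto simp: cuts_def)
    show "s \<in> S"
    proof (cases "\<exists>t. t \<in> S \<and> Q a \<le> t")
      case True
      define t where "t = (LEAST t. t \<in> S \<and> Q a \<le> t)"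
      have "t \<in> S" "Q a \<le> t" using LeastI_ex[OF True] by (auto simp: t_def)
      moreover have "t \<le> t'" if "t' \<in> S" "Q a \<le> t'" for t' unfolding t_def using that by (auto intro: Least_le)
      ultimately show ?thesis using least[OF a(1), of t] a(2) by auto
    next
      case False
      then have "{b \<in> X. (b, a) \<in> cut_face X Q S} = X" using down[OF a(1)] by auto
      then show ?thesis using a by simp
    qed
  next
    fix s assume s: "s \<in> S"
    then have s': "1 \<le> s" "s < card X" using assms(3) by force+
    then obtain a where "a \<in> X" "Q a = s" using Q(3) by (metis atLeastAtMost_iff imageE less_imp_le)
    then show "s \<in> cuts X (cut_face X Q S)"
      using least[of a s] s s' by (auto simp: cuts_def image_iff intro!: bexI[of _ a])
  qed
qed

text \<open>A face coarser than the order of \<open>Q\<close> has intervals of \<open>Q\<close> as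
  blocks, so \<open>d a\<close> is the position of the last element in the block of
  \<open>a\<close>, and these positions determine the face.\<close>

lemma cut_face_cuts:
  assumes "finite X" "Q \<in> linear_extensions X r" "F \<in> faces X r" "order_of X Q \<subseteq> F"
  shows "cut_face X Q (cuts X F) = F" "cuts X F \<subseteq> {1..card X - 1}"
proof -
  note Q = linear_extensionsD[OF assms(2)]
  define d where "d a = card {b \<in> X. (b, a) \<in> F}" for a
  have le: "d a \<le> d b \<longleftrightarrow> (a, b) \<in> F" if "a \<in> X" "b \<in> X" for a b
    unfolding d_def by (rule face_rank_le_iff[OF assms(1,3) that])
  have d_le: "d a \<le> card X" for a unfolding d_def using assms(1) by (auto intro: card_mono)
  have Q_le: "Q a \<le> card X" if "a \<in> X" for a using Q(3) that by auto
  have tr: "(a, c) \<in> F" if "(a, b) \<in> F" "(b, c) \<in> F" for a b c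
    using assms(3) that unfolding faces_def by (blast dest: transD)
  have ext: "(a, b) \<in> F" if "a \<in> X" "b \<in> X" "Q a \<le> Q b" for a b
    using assms(4) that by (auto simp: order_of_def)
  \<comment> \<open>Lower sets of \<open>F\<close> are lower sets of \<open>Q\<close>, hence determined by their cardinality.\<close>
  have down: "(b, a) \<in> F \<longleftrightarrow> Q b \<le> d a" if "a \<in> X" "b \<in> X" for a b
  proof
    assume ba: "(b, a) \<in> F"
    have "{c \<in> X. Q c \<le> Q b} \<subseteq> {c \<in> X. (c, a) \<in> F}"
      using ba that by (blast intro: ext tr)
    then have "card {c \<in> X. Q c \<le> Q b} \<le> d a"
      unfolding d_def using assms(1) by (auto intro: card_mono)
    then show "Q b \<le> d a" using card_initial_segment[OF assms(2) Q_le[OF that(2)]] by simp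
  next
    assume ba: "Q b \<le> d a"
    show "(b, a) \<in> F"
    proof (rule ccontr)
      assume no: "(b, a) \<notin> F"
      have "Q c < Q b" if "c \<in> X" "(c, a) \<in> F" for c
        using no that ext[OF \<open>b \<in> X\<close> that(1)] tr by (meson not_le)
      then have "{c \<in> X. (c, a) \<in> F} \<subseteq> {c \<in> X. Q c \<le> Q b - 1}" by fastforce
      then have "d a \<le> card {c \<in> X. Q c \<le> Q b - 1}"
        unfolding d_def using assms(1) by (auto intro: card_mono)
      then have "d a \<le> Q b - 1"
        using card_initial_segment[OF assms(2), of "Q b - 1"] Q_le[OF that(2)] by simp
      moreover have "Q b \<ge> 1" using Q(3) that by auto
      ultimately show False using ba by simp
    qed
  qed
  have refl: "(a, a) \<in> F" if "a \<in> X" for a using assms(3) that by (auto simp: faces_def)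
  have "(b, a) \<in> cut_face X Q (cuts X F) \<longleftrightarrow> (b, a) \<in> F" if ab: "a \<in> X" "b \<in> X" for a b
  proof
    assume "(b, a) \<in> cut_face X Q (cuts X F)"
    \<comment> \<open>The cut to test is \<open>d a\<close> itself. If it equals
      \<open>card X\<close> it is no cut, but then \<open>Q b \<le> d a\<close> holds
      anyway.\<close>
    then have "d a \<noteq> card X \<longrightarrow> Q a \<le> d a \<longrightarrow> Q b \<le> d a"
      using ab by (auto simp: cut_face_def cuts_def d_def)
    moreover have "Q a \<le> d a" using down[OF ab(1,1)] refl ab by simp
    ultimately have "Q b \<le> d a" using Q_le[OF ab(2)] by fastforce
    then show "(b, a) \<in> F" using down ab by simp
  next
    assume ba: "(b, a) \<in> F"
    have "Q b \<le> d c" if c: "c \<in> X" "Q a \<le> d c" for c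
    proof -
      have "d a \<le> d c" using down[OF c(1) ab(1)] le[OF ab(1) c(1)] c(2) by simp
      then show ?thesis using down[OF ab] ba by simp
    qed
    then show "(b, a) \<in> cut_face X Q (cuts X F)"
      using ab by (auto simp: cut_face_def cuts_def d_def)
  qed
  then show "cut_face X Q (cuts X F) = F"
    using assms(3) by (auto simp: faces_def cut_face_def)
  have "d a \<ge> 1" if "a \<in> X" for a
  proof -
    have "1 \<le> Q a" using Q(3) that by auto
    then show ?thesis using down[OF that that] refl[OF that] by simp
  qed
  then show "cuts X F \<subseteq> {1..card X - 1}"
    using d_le by (force simp: cuts_def d_def[symmetric] le_less)
qed

text \<open>The product equals the order of \<open>Q\<close> exactly when \<open>P\<close> increases
  along \<open>Q\<close> inside every block. Equivalently, consecutive elements forming a descent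
  never share a block, so that each descent is a cut.\<close>

lemma cut_face_mult_iff:
  assumes "P \<in> linear_extensions X r" "Q \<in> linear_extensions X r"
  shows "face_mult (cut_face X Q S) (order_of X P) = order_of X Q \<longleftrightarrow> descents X P Q \<subseteq> S"
proof
  note P = linear_extensionsD[OF assms(1)] and Q = linear_extensionsD[OF assms(2)]
  assume eq: "face_mult (cut_face X Q S) (order_of X P) = order_of X Q"
  show "descents X P Q \<subseteq> S"
  proof
    fix k assume k: "k \<in> descents X P Q"
    then have k': "k \<in> Q ` X" "k + 1 \<in> Q ` X" unfolding Q(3) by (auto simp: descents_def)
    define a b where "a = inv_into X Q k" and "b = inv_into X Q (k + 1)"
    have ab: "a \<in> X" "b \<in> X" "Q a = k" "Q b = k + 1"
      using k' by (auto simp: a_def b_def inv_into_into f_inv_into_f)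
    have "P b < P a" using k by (auto simp: descents_def a_def b_def)
    moreover have "(a, b) \<in> face_mult (cut_face X Q S) (order_of X P)"
      using ab unfolding eq by (simp add: order_of_def)
    ultimately have "(b, a) \<notin> cut_face X Q S" by (auto simp: face_mult_def order_of_def)
    \<comment> \<open>A cut separates the neighbouring positions \<open>k\<close> and
      \<open>k + 1\<close>, which leaves only \<open>s = k\<close>.\<close>
    then obtain s where "s \<in> S" "Q a \<le> s" "\<not> Q b \<le> s" using ab by (auto simp: cut_face_def)
    then have "s = k" using ab by simp
    then show "k \<in> S" using \<open>s \<in> S\<close> by simp
  qed
next
  note P = linear_extensionsD[OF assms(1)] and Q = linear_extensionsD[OF assms(2)]
  assume sub: "descents X P Q \<subseteq> S"
  \<comment> \<open>The last condition says that no cut lies in \<open>{i..<j}\<close>, so no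
    descent does either, and \<open>P\<close> increases step by step.\<close>
  have inc: "P (inv_into X Q i) \<le> P (inv_into X Q j)"
    if "1 \<le> i" "i \<le> j" "j \<le> card X" "\<And>s. s \<in> S \<Longrightarrow> i \<le> s \<Longrightarrow> j \<le> s" for i j
    using that(2,1,3,4)
  proof (induction j rule: dec_induct)
    case (step j)
    have "j \<notin> S" using step.prems(3)[of j] step.hyps by auto
    then have "j \<notin> descents X P Q" using sub by auto
    then have "P (inv_into X Q j) \<le> P (inv_into X Q (Suc j))"
      using step.prems step.hyps by (auto simp: descents_def)
    moreover have "P (inv_into X Q i) \<le> P (inv_into X Q j)"
      using step.prems by (intro step.IH) (auto dest: Suc_leD)
    ultimately show ?case by simp
  qed simp
  have *: "P a \<le> P b" if "a \<in> X" "b \<in> X" "Q a \<le> Q b" "(b, a) \<in> cut_face X Q S" for a b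
  proof -
    have "Q a \<in> {1..card X}" "Q b \<in> {1..card X}" using that(1,2) Q(3) by auto
    then have "P (inv_into X Q (Q a)) \<le> P (inv_into X Q (Q b))"
      using that by (intro inc) (auto simp: cut_face_def)
    then show ?thesis using that(1,2) by (simp add: inv_into_f_f[OF Q(2)])
  qed
  have "(a, b) \<in> face_mult (cut_face X Q S) (order_of X P) \<longleftrightarrow> Q a \<le> Q b"
    if ab: "a \<in> X" "b \<in> X" for a b
  proof
    assume "Q a \<le> Q b"
    then show "(a, b) \<in> face_mult (cut_face X Q S) (order_of X P)"
      using * ab by (auto simp: face_mult_def cut_face_def order_of_def)
  next
    assume l: "(a, b) \<in> face_mult (cut_face X Q S) (order_of X P)"
    show "Q a \<le> Q b"
    proof (rule ccontr)
      assume ba: "\<not> Q a \<le> Q b"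
      then have "(b, a) \<in> cut_face X Q S" using ab by (auto simp: cut_face_def)
      then have "P a \<le> P b" using l by (auto simp: face_mult_def order_of_def)
      moreover have "P b \<le> P a" using * ab ba l by (auto simp: face_mult_def)
      ultimately have "a = b" using P(2) ab by (auto simp: inj_on_def)
      then show False using ba by simp
    qed
  qed
  then show "face_mult (cut_face X Q S) (order_of X P) = order_of X Q"
    by (auto simp: order_of_def face_mult_def cut_face_def)
qed

text \<open>A face taking \<open>P\<close> to \<open>Q\<close> contains the order of
  \<open>Q\<close>, so its cut set determines it; \<open>cut_face_mult_iff\<close> tells which cut
  sets occur.\<close>

lemma sum_faces_cuts:
  assumes "finite X" "P \<in> linear_extensions X r" "Q \<in> linear_extensions X r"
  shows "(\<Sum>F | F \<in> faces X r \<and> face_act X F P = Q. \<beta> (cuts X F)) =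
    (\<Sum>S | descents X P Q \<subseteq> S \<and> S \<subseteq> {1..card X - 1}. \<beta> S)"
proof (rule sum.reindex_bij_witness[of _ "cut_face X Q" "cuts X"])
  fix F assume F: "F \<in> {F \<in> faces X r. face_act X F P = Q}"
  then have eq: "face_mult F (order_of X P) = order_of X Q"
    using face_act_eq_iff[OF assms(1) _ assms(2,3)] by blast
  then have "order_of X Q \<subseteq> F" by (auto simp: face_mult_def)
  then have *: "cut_face X Q (cuts X F) = F" "cuts X F \<subseteq> {1..card X - 1}"
    using F cut_face_cuts[OF assms(1,3)] by blast+
  then show "cut_face X Q (cuts X F) = F" by simp
  show "cuts X F \<in> {S. descents X P Q \<subseteq> S \<and> S \<subseteq> {1..card X - 1}}"
    using cut_face_mult_iff[OF assms(2,3), of "cuts X F"] * eq by auto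
next
  fix S assume S: "S \<in> {S. descents X P Q \<subseteq> S \<and> S \<subseteq> {1..card X - 1}}"
  then show "cuts X (cut_face X Q S) = S" using cuts_cut_face[OF assms(1,3)] by blast
  show "cut_face X Q S \<in> {F \<in> faces X r. face_act X F P = Q}"
    using S cut_face_mult_iff[OF assms(2,3)] face_act_eq_iff[OF assms(1) _ assms(2,3)]
      cut_face_faces[OF assms(3)] by blast
qed auto

section \<open>Evaluation of polynomials and integer spans\<close>

text \<open>The additive extension of \<open>h\<close> from monomials to integer polynomials; it is
  a ring homomorphism once \<open>h\<close> is multiplicative.\<close>

definition poly_mapping_eval :: "('k \<Rightarrow> 'r::comm_ring_1) \<Rightarrow> ('k \<Rightarrow>\<^sub>0 int) \<Rightarrow> 'r" where
  "poly_mapping_eval h p = (\<Sum>k\<in>Poly_Mapping.keys p. of_int (Poly_Mapping.lookup p k) * h k)"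

lemma poly_mapping_eval_single [simp]:
  "poly_mapping_eval h (Poly_Mapping.single k c) = of_int c * h k"
  by (simp add: poly_mapping_eval_def)

lemma poly_mapping_eval_add:
  "poly_mapping_eval h (p + q) = poly_mapping_eval h p + poly_mapping_eval h q"
  unfolding poly_mapping_eval_def by (rule setsum_keys_plus_distrib) (simp_all add: distrib_right)

lemma poly_mapping_eval_sum:
  "poly_mapping_eval h (sum p A) = (\<Sum>x\<in>A. poly_mapping_eval h (p x))"
  by (induction A rule: infinite_finite_induct)
    (simp_all add: poly_mapping_eval_add, simp_all add: poly_mapping_eval_def)

lemma poly_mapping_sum_single:
  "p = (\<Sum>k\<in>Poly_Mapping.keys p. Poly_Mapping.single k (Poly_Mapping.lookup p k))"
proof (rule poly_mapping_eqI)
  fix l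
  have "(\<Sum>k\<in>Poly_Mapping.keys p. Poly_Mapping.lookup p k when k = l) = Poly_Mapping.lookup p l"
    by (simp add: when_def in_keys_iff)
  then show "Poly_Mapping.lookup p l = Poly_Mapping.lookup
      (\<Sum>k\<in>Poly_Mapping.keys p. Poly_Mapping.single k (Poly_Mapping.lookup p k)) l"
    by (simp add: lookup_sum lookup_single)
qed

lemma comm_ring_hom_poly_mapping_eval:
  fixes h :: "'k::comm_monoid_add \<Rightarrow> 'r::comm_ring_1"
  assumes "h 0 = 1" and h: "\<And>k l. h (k + l) = h k * h l"
  shows "comm_ring_hom (poly_mapping_eval h)"
proof
  fix p q :: "'k \<Rightarrow>\<^sub>0 int"
  have "p * q = (\<Sum>k\<in>Poly_Mapping.keys p. \<Sum>l\<in>Poly_Mapping.keys q. Poly_Mapping.single (k + l) (Poly_Mapping.lookup p k * Poly_Mapping.lookup q l))"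
    by (subst poly_mapping_sum_single[of p], subst poly_mapping_sum_single[of q])
      (simp add: sum_product mult_single)
  then have "poly_mapping_eval h (p * q) =
      (\<Sum>k\<in>Poly_Mapping.keys p. \<Sum>l\<in>Poly_Mapping.keys q. (of_int (Poly_Mapping.lookup p k) * h k) * (of_int (Poly_Mapping.lookup q l) * h l))"
    by (simp add: poly_mapping_eval_sum h algebra_simps)
  then show "poly_mapping_eval h (p * q) = poly_mapping_eval h p * poly_mapping_eval h q"
    by (simp add: poly_mapping_eval_def sum_product)
next
  have "(1 :: 'k \<Rightarrow>\<^sub>0 int) = Poly_Mapping.single 0 1" by simp
  then show "poly_mapping_eval h 1 = 1" using assms(1) by (metis mult_1 of_int_1 poly_mapping_eval_single)
qed (auto simp: poly_mapping_eval_add, simp add: poly_mapping_eval_def)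

definition monomial_eval :: "('v \<Rightarrow> 'r::comm_monoid_mult) \<Rightarrow> ('v \<Rightarrow>\<^sub>0 nat) \<Rightarrow> 'r" where
  "monomial_eval v m = (\<Prod>i\<in>Poly_Mapping.keys m. v i ^ Poly_Mapping.lookup m i)"

text \<open>Absent variables have exponent 0 and contribute 1. This lets two monomials and their
  product be evaluated over one index set.\<close>

lemma monomial_eval_superset:
  "finite A \<Longrightarrow> Poly_Mapping.keys m \<subseteq> A \<Longrightarrow> monomial_eval v m = (\<Prod>i\<in>A. v i ^ Poly_Mapping.lookup m i)"
  unfolding monomial_eval_def by (rule prod.mono_neutral_left) (auto simp: in_keys_iff)

lemma monomial_eval_add: "monomial_eval v (m + m') = monomial_eval v m * monomial_eval v m'"
proof -
  have *: "monomial_eval v k = (\<Prod>i\<in>Poly_Mapping.keys m \<union> Poly_Mapping.keys m'. v i ^ Poly_Mapping.lookup k i)"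
    if "Poly_Mapping.keys k \<subseteq> Poly_Mapping.keys m \<union> Poly_Mapping.keys m'" for k
    using that by (intro monomial_eval_superset) auto
  show ?thesis
    by (simp add: *[of m] *[of m'] *[OF Poly_Mapping.keys_add] lookup_add power_add prod.distrib)
qed

section \<open>Integer spans and Moebius inversion\<close>

definition int_span :: "'b set \<Rightarrow> ('b \<Rightarrow> 'd::comm_ring_1) \<Rightarrow> 'd set" where
  "int_span E a = range (\<lambda>c. \<Sum>e\<in>E. of_int (c e) * a e)"

lemma int_spanI: "x = (\<Sum>e\<in>E. of_int (c e) * a e) \<Longrightarrow> x \<in> int_span E a"
  by (auto simp: int_span_def)

lemma int_span_gen:
  assumes "finite E" "e \<in> E"
  shows "a e \<in> int_span E a"
proof (rule int_spanI)
  have "(\<Sum>x\<in>E. of_int (if x = e then 1 else 0) * a x) = (\<Sum>x\<in>E. if x = e then a x else 0)"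
    by (rule sum.cong) auto
  also have "\<dots> = a e" using assms by simp
  finally show "a e = (\<Sum>x\<in>E. of_int (if x = e then 1 else 0) * a x)" ..
qed

lemma int_span_scale:
  assumes "x \<in> int_span E a"
  shows "of_int z * x \<in> int_span E a"
proof -
  obtain c where "x = (\<Sum>e\<in>E. of_int (c e) * a e)" using assms by (auto simp: int_span_def)
  then have "of_int z * x = (\<Sum>e\<in>E. of_int (z * c e) * a e)"
    by (simp add: sum_distrib_left mult.assoc)
  then show ?thesis by (rule int_spanI)
qed

lemma int_span_sum:
  assumes "\<And>y. y \<in> Y \<Longrightarrow> f y \<in> int_span E a"
  shows "sum f Y \<in> int_span E a"
proof -
  have "\<forall>y\<in>Y. \<exists>c. f y = (\<Sum>e\<in>E. of_int (c e) * a e)"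
    using assms by (auto simp: int_span_def)
  then obtain c where "\<forall>y\<in>Y. f y = (\<Sum>e\<in>E. of_int (c y e) * a e)" by metis
  then have "sum f Y = (\<Sum>y\<in>Y. \<Sum>e\<in>E. of_int (c y e) * a e)" by simp
  also have "\<dots> = (\<Sum>e\<in>E. of_int (\<Sum>y\<in>Y. c y e) * a e)"
    by (subst sum.swap) (simp add: sum_distrib_right)
  finally show ?thesis by (rule int_spanI)
qed

text \<open>Moebius inversion over supersets within \<open>U\<close> has coefficients 1 and -1, so
  the weights stay in the integer span.\<close>

lemma moebius_weights:
  fixes a :: "nat set \<Rightarrow> 'd::comm_ring_1"
  assumes "finite U" and a: "\<And>S. S \<subseteq> U \<Longrightarrow> a S \<in> int_span E b"
  obtains \<beta> where "\<And>S. \<beta> S \<in> int_span E b"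
    and "\<And>D. D \<subseteq> U \<Longrightarrow> (\<Sum>S | D \<subseteq> S \<and> S \<subseteq> U. \<beta> S) = a D"
proof -
  \<comment> \<open>Complements in \<open>U\<close> turn sums over supersets into sums over subsets,
    the form of \<open>inclusion_exclusion_symmetric\<close>.\<close>
  define g where "g W = (\<Sum>Z\<in>Pow W. (-1) ^ card Z * a (U - Z))" for W
  define \<beta> where "\<beta> S = (-1) ^ card (U - S) * g (U - S)" for S
  have neg: "(-1) ^ k * x \<in> int_span E b" if "x \<in> int_span E b" for k x
    using int_span_scale[OF that, of "(-1) ^ k"] by simp
  have "\<beta> S \<in> int_span E b" for S
    unfolding \<beta>_def g_def by (intro neg int_span_sum a) auto
  moreover have "(\<Sum>S | D \<subseteq> S \<and> S \<subseteq> U. \<beta> S) = a D" if D: "D \<subseteq> U" for D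
  proof -
    have "(\<Sum>S | D \<subseteq> S \<and> S \<subseteq> U. \<beta> S) = (\<Sum>W\<in>Pow (U - D). (-1) ^ card W * g W)"
      by (rule sum.reindex_bij_witness[of _ "\<lambda>W. U - W" "\<lambda>S. U - S"])
        (use D in \<open>auto simp: \<beta>_def double_diff\<close>)
    also have "\<dots> = a (U - (U - D))"
      using inclusion_exclusion_symmetric[of g "\<lambda>Z. a (U - Z)" "U - D"] assms
      by (simp add: g_def)
    also have "U - (U - D) = D" using D by auto
    finally show ?thesis .
  qed
  ultimately show ?thesis using that by blast
qed

definition sign_of :: "nat \<Rightarrow> nat set \<Rightarrow> nat \<Rightarrow> nat" where
  "sign_of n S = (\<lambda>k\<in>{1..n - 1}. if k \<in> S then 1 else 0)"

section \<open>Integral linear eigenvalues\<close>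

text \<open>Values in a domain allow a divisor of a product of linear factors to be split. The roots
  are sums of weights \<open>w F\<close>, each of them an integer combination of the values of
  \<open>a\<close>.\<close>

lemma char_poly_extension_idom:
  fixes a :: "(nat \<Rightarrow> nat) \<Rightarrow> 'd::idom"
  assumes X: "finite X" and Ps: "distinct Ps" "set Ps = linear_extensions X r"
  shows "\<exists>bs. length bs = length Ps \<and> set bs \<subseteq> int_span (signs (card X)) a \<and>
    char_poly (mat (length Ps) (length Ps) (\<lambda>(i, j). a (disagreement_sign X (Ps ! i) (Ps ! j)))) =
      (\<Prod>b\<leftarrow>bs. [:- b, 1:])"
proof -
  define N where "N = length Ps"
  define C where "C = linear_extensions X r"
  define M where "M = mat N N (\<lambda>(i, j). a (disagreement_sign X (Ps ! i) (Ps ! j)))"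
  have M: "M \<in> carrier_mat N N" by (simp add: M_def)
  have finC: "finite C" using X by (simp add: C_def finite_linear_extensions)
  have bij: "bij_betw ((!) Ps) {..<N} C"
    unfolding N_def C_def by (rule bij_betw_nth[OF Ps(1) refl Ps(2)[symmetric]])
  obtain \<beta> where \<beta>: "\<And>S. \<beta> S \<in> int_span (signs (card X)) a"
    and sum_\<beta>: "\<And>D. D \<subseteq> {1..card X - 1} \<Longrightarrow>
      (\<Sum>S | D \<subseteq> S \<and> S \<subseteq> {1..card X - 1}. \<beta> S) = a (sign_of (card X) D)"
  proof (rule moebius_weights[of "{1..card X - 1}" "\<lambda>S. a (sign_of (card X) S)" "signs (card X)" a])
    show "a (sign_of (card X) S) \<in> int_span (signs (card X)) a" for S
      by (rule int_span_gen) (auto simp: signs_def sign_of_def finite_PiE split: if_splits)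
  qed auto
  define w where "w F = \<beta> (cuts X F)" for F
  \<comment> \<open>An entry of the matrix is the total weight of the faces taking the row index
    \<open>P\<close> to the column index \<open>Q\<close>.\<close>
  have entry: "(\<Sum>F | F \<in> faces X r \<and> face_act X F P = Q. w F) = a (disagreement_sign X P Q)"
    if "P \<in> C" "Q \<in> C" for P Q
  proof -
    have "(\<Sum>F | F \<in> faces X r \<and> face_act X F P = Q. w F) = a (sign_of (card X) (descents X P Q))"
      unfolding w_def sum_faces_cuts[OF X that[unfolded C_def]]
      by (rule sum_\<beta>) (auto simp: descents_def)
    also have "sign_of (card X) (descents X P Q) = disagreement_sign X P Q"
      unfolding sign_of_def by (rule disagreement_sign_descents[OF that(2)[unfolded C_def], symmetric])
    finally show ?thesis .
  qed
  have act: "face_act X F P \<in> C" if "F \<in> faces X r" "P \<in> C" for F P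
    using face_act(1)[OF X] that by (simp add: C_def)
  \<comment> \<open>This is the annihilator statement at the one-block face
    \<open>X \<times> X\<close>, which fixes every linear extension.\<close>
  define annihilates where "annihilates As \<longleftrightarrow> (\<forall>f. \<exists>h. \<forall>P\<in>C.
      (\<Prod>A\<leftarrow>As. [:- sum w A, 1:]) * f (face_act X (X \<times> X) P) =
      [:0, 1:] * h P - (\<Sum>F\<in>faces X r. [:w F:] * h (face_act X F P)))" for As
  have "\<exists>As. (\<forall>A\<in>set As. A \<subseteq> faces X r) \<and> annihilates As"
    unfolding annihilates_def
  proof (rule left_action_annihilator[where mul = face_mult and \<mu> = card])
    show "face_act X (face_mult G F) P = face_act X G (face_act X F P)"
      if "F \<in> faces X r" "P \<in> C" for G F P
      using that unfolding C_def by (rule face_act_mult[OF X])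
    show "card (face_mult G F) < card G" if "G \<in> faces X r" "face_mult G F \<noteq> G" for G F
      using that by (rule card_face_mult_less[OF X])
  qed (fact finite_faces[OF X] face_mult_faces act top_face)+
  then obtain As where ann: "annihilates As" by blast
  define p where "p = (\<Prod>A\<leftarrow>As. [:- sum w A, 1:])"
  have "char_poly M dvd p ^ N"
  proof (rule char_poly_dvd_power[OF M])
    fix j assume j: "j < N"
    \<comment> \<open>Taking \<open>f\<close> to be the indicator of \<open>Ps ! j\<close> gives the
      column that \<open>char_poly_dvd_power\<close> requires.\<close>
    obtain h where h: "\<And>P. P \<in> C \<Longrightarrow> p * (if P = Ps ! j then 1 else 0) =
        [:0, 1:] * h P - (\<Sum>F\<in>faces X r. [:w F:] * h (face_act X F P))"
    proof -
      have "\<exists>h. \<forall>P\<in>C. p * (if face_act X (X \<times> X) P = Ps ! j then 1 else 0) =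
          [:0, 1:] * h P - (\<Sum>F\<in>faces X r. [:w F:] * h (face_act X F P))"
        unfolding p_def
        by (rule ann[unfolded annihilates_def, THEN spec, of "\<lambda>P. if P = Ps ! j then 1 else 0"])
      then obtain h where "\<forall>P\<in>C. p * (if face_act X (X \<times> X) P = Ps ! j then 1 else 0) =
          [:0, 1:] * h P - (\<Sum>F\<in>faces X r. [:w F:] * h (face_act X F P))"
        by (rule exE)
      moreover have "face_act X (X \<times> X) P = P" if "P \<in> C" for P
        using that unfolding C_def by (rule face_act_top)
      ultimately show ?thesis using that[of h] by simp
    qed
    have "(if i = j then p else 0) =
      [:0, 1:] * h (Ps ! i) - (\<Sum>k<N. [:M $$ (i, k):] * h (Ps ! k))" if i: "i < N" for i
    proof -
      have Pi: "Ps ! i \<in> C" using bij i by (auto simp: bij_betw_def)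
      have "(\<Sum>k<N. [:M $$ (i, k):] * h (Ps ! k)) =
          (\<Sum>k<N. [:a (disagreement_sign X (Ps ! i) (Ps ! k)):] * h (Ps ! k))"
        using i by (simp add: M_def)
      also have "\<dots> = (\<Sum>Q\<in>C. [:a (disagreement_sign X (Ps ! i) Q):] * h Q)"
        by (rule sum.reindex_bij_betw[OF bij])
      \<comment> \<open>Each entry is expanded over faces. Every face sends \<open>Ps ! i\<close> to
        exactly one \<open>Q\<close> in \<open>C\<close>, so the double sum then runs once over all
        faces.\<close>
      also have "\<dots> = (\<Sum>Q\<in>C. \<Sum>F | F \<in> faces X r \<and> face_act X F (Ps ! i) = Q. [:w F:] * h (face_act X F (Ps ! i)))"
        by (rule sum.cong) (simp_all add: entry[OF Pi, symmetric] sum_to_poly[symmetric] sum_distrib_right)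
      also have "\<dots> = (\<Sum>F\<in>faces X r. [:w F:] * h (face_act X F (Ps ! i)))"
        using act Pi finC finite_faces[OF X] by (intro sum.group) auto
      finally have "[:0, 1:] * h (Ps ! i) - (\<Sum>k<N. [:M $$ (i, k):] * h (Ps ! k)) =
          p * (if Ps ! i = Ps ! j then 1 else 0)"
        using h[OF Pi] by simp
      also have "\<dots> = (if i = j then p else 0)"
        using Ps(1) i j by (simp add: N_def nth_eq_iff_index_eq)
      finally show ?thesis ..
    qed
    then show "\<exists>h. \<forall>i<N. (if i = j then p else 0) = [:0, 1:] * h i - (\<Sum>k<N. [:M $$ (i, k):] * h k)"
      by (intro exI[of _ "\<lambda>k. h (Ps ! k)"]) blast
  qed
  also have "p ^ N = (\<Prod>b\<leftarrow>concat (replicate N (map (sum w) As)). [:- b, 1:])"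
    by (induction N) (simp_all add: p_def o_def)
  finally obtain bs where bs: "set bs \<subseteq> set (concat (replicate N (map (sum w) As)))"
    "char_poly M = (\<Prod>b\<leftarrow>bs. [:- b, 1:])"
    using monic_dvd_prod_linear[of "char_poly M"] degree_monic_char_poly[OF M] by metis
  have "sum w A \<in> int_span (signs (card X)) a" for A
    using \<beta> unfolding w_def by (intro int_span_sum)
  then have "set bs \<subseteq> int_span (signs (card X)) a"
    using bs(1) by (auto split: if_splits)
  \<comment> \<open>Comparison of degrees: the characteristic polynomial has degree
    \<open>N\<close>.\<close>
  moreover have "length bs = N"
    using degree_linear_factors[of uminus bs] degree_monic_char_poly[OF M] bs(2) by simp
  ultimately show ?thesis using bs(2) unfolding M_def N_def by blast
qed

section \<open>Transfer to the sign variables\<close>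

theorem theorem1:
  fixes X :: "'a set" and r :: "('a \<times> 'a) set" and Ps :: "('a \<Rightarrow> nat) list"
  assumes "finite X"
    and "partial_order_on X r"
    and "distinct Ps" and "set Ps = linear_extensions X r"
  shows "\<exists>m :: nat \<Rightarrow> (nat \<Rightarrow> nat) \<Rightarrow> int.
           char_poly (extension_matrix X Ps) =
             (\<Prod>i = 1..card (linear_extensions X r).
                [:- (\<Sum>\<epsilon>\<in>signs (card X). of_int (m i \<epsilon>) * sign_var \<epsilon>), 1:])"
proof -
  define N where "N = length Ps"
  have N: "card (linear_extensions X r) = N"
    using distinct_card[OF assms(3)] by (simp add: N_def assms(4))
  have fin: "finite (signs n)" for n by (simp add: signs_def finite_PiE)
  obtain idx :: "(nat \<Rightarrow> nat) \<Rightarrow> nat" where idx: "inj_on idx (signs (card X))"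
    using finite_imp_inj_to_nat_seg[OF fin] by blast
  \<comment> \<open>Functions on the naturals carry no linear order, so the library does not know the polynomial
    ring over them to be a domain; we therefore work in a copy with variables named by naturals.\<close>
  define a :: "(nat \<Rightarrow> nat) \<Rightarrow> (nat \<Rightarrow>\<^sub>0 nat) \<Rightarrow>\<^sub>0 int" where
    "a \<epsilon> = Poly_Mapping.single (Poly_Mapping.single (idx \<epsilon>) 1) 1" for \<epsilon>
  \<comment> \<open>This renames variable \<open>i\<close> back to the sign numbered
    \<open>i\<close> by \<open>idx\<close>. Numbers outside the range of \<open>idx\<close> get an
    unspecified variable, but they do not occur in \<open>A\<close>.\<close>
  define \<phi> :: "((nat \<Rightarrow>\<^sub>0 nat) \<Rightarrow>\<^sub>0 int) \<Rightarrow> sign_poly" where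
    "\<phi> = poly_mapping_eval (monomial_eval (\<lambda>i. sign_var (inv_into (signs (card X)) idx i)))"
  interpret \<phi>: comm_ring_hom \<phi>
    unfolding \<phi>_def
    by (rule comm_ring_hom_poly_mapping_eval) (simp_all add: monomial_eval_add, simp add: monomial_eval_def)
  interpret map_\<phi>: map_poly_comm_ring_hom \<phi> ..
  have \<phi>_a: "\<phi> (a \<epsilon>) = sign_var \<epsilon>" if "\<epsilon> \<in> signs (card X)" for \<epsilon>
    using that idx by (simp add: \<phi>_def a_def monomial_eval_def)
  define A where "A = mat N N (\<lambda>(i, j). a (disagreement_sign X (Ps ! i) (Ps ! j)))"
  obtain bs where bs: "length bs = N" "set bs \<subseteq> int_span (signs (card X)) a"
    "char_poly A = (\<Prod>b\<leftarrow>bs. [:- b, 1:])"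
    using char_poly_extension_idom[OF assms(1,3,4)] unfolding A_def N_def by metis
  \<comment> \<open>Characteristic polynomials commute with ring homomorphisms, so the factorization
    over the copy is carried over by \<phi>.\<close>
  have "map_mat \<phi> A = extension_matrix X Ps"
    by (rule eq_matI) (auto simp: A_def extension_matrix_def N_def \<phi>_a disagreement_sign_in_signs)
  moreover have "A \<in> carrier_mat N N" by (simp add: A_def)
  ultimately have "char_poly (extension_matrix X Ps) = map_poly \<phi> (\<Prod>b\<leftarrow>bs. [:- b, 1:])"
    using \<phi>.char_poly_hom bs(3) by metis
  also have "\<dots> = (\<Prod>b\<leftarrow>bs. [:- \<phi> b, 1:])"
    by (simp add: map_\<phi>.hom_prod_list o_def \<phi>.map_poly_pCons_hom \<phi>.hom_uminus)
  \<comment> \<open>List positions start at 0 and the eigenvalues are numbered from 1, hence the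
    index \<open>i - 1\<close>.\<close>
  also have "\<dots> = (\<Prod>i = 1..N. [:- \<phi> (bs ! (i - 1)), 1:])"
    unfolding prod.list_conv_set_nth using bs(1)
    by (intro prod.reindex_bij_witness[of _ "\<lambda>i. i - 1" Suc]) auto
  finally have cp: "char_poly (extension_matrix X Ps) = (\<Prod>i = 1..N. [:- \<phi> (bs ! (i - 1)), 1:])" .
  have "\<exists>c. \<phi> (bs ! (i - 1)) = (\<Sum>\<epsilon>\<in>signs (card X). of_int (c \<epsilon>) * sign_var \<epsilon>)"
    if "i \<in> {1..N}" for i
  proof -
    have "bs ! (i - 1) \<in> int_span (signs (card X)) a" using bs(1,2) that by auto
    then obtain c where "bs ! (i - 1) = (\<Sum>\<epsilon>\<in>signs (card X). of_int (c \<epsilon>) * a \<epsilon>)"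
      by (auto simp: int_span_def)
    then show ?thesis by (intro exI[of _ c]) (simp add: \<phi>.hom_of_int \<phi>.hom_sum \<phi>.hom_mult \<phi>_a)
  qed
  then obtain m where "\<And>i. i \<in> {1..N} \<Longrightarrow>
      \<phi> (bs ! (i - 1)) = (\<Sum>\<epsilon>\<in>signs (card X). of_int (m i \<epsilon>) * sign_var \<epsilon>)"
    by metis
  then show ?thesis unfolding N cp by (intro exI[of _ m] prod.cong) auto
qed

end
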